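(* Let $D=(V,A)$ be an AUSO of the graph of a simple $4$-polytope, let $v_{\mathrm{st}}\in V$ be an arbitrary starting vertex, and let $\lambda:V\to\mathbb{Z}$ be an effectively decreasing function on $D$. Then the expected number of pivot steps of the random edge algorithm started at $v_{\mathrm{st}}$ until it reaches the global sink of $D$ is at most $4\,|\lambda(V)|$.
   Context: An orientation $D$ of the graph (1-skeleton) of a polytope $P$ is an acyclic unique sink orientation (AUSO) if $D$ is acyclic and for every nonempty face $F$ of $P$ the subgraph of $D$ induced by the vertices of $F$ has a unique sink; the global sink is the unique sink of $D$. A polytope is simple if each vertex lies in exactly $d$ facets; for a simple $4$-polytope every vertex has degree $4$ in the graph. A function $\lambda:V\to\mathbb{Z}$ is monotone decreasing on $D$ if $\lambda(v)\ge\lambda(w)$ for every arc $(v,w)\in A$; it is effectively decreasing if it is monotone decreasing and every vertex $v\in V$ that is not the global sink has an outgoing arc $(v,w)\in A$ with $\lambda(v)>\lambda(w)$. The random edge algorithm: at the current vertex, if it is not the global sink, move along an outgoing arc chosen uniformly at random among its outgoing arcs; a pivot step is one such move. *)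

theory Defs
  imports "HOL-Probability.Probability"
begin

section \<open>Simple polytopes and their graphs\<close>

definition vertices :: "'a::euclidean_space set \<Rightarrow> 'a set" where
  "vertices P = {v. v extreme_point_of P}"

text \<open>The graph (1-skeleton) of a polytope, as a symmetric adjacency relation on its vertices.\<close>

definition edges :: "'a::euclidean_space set \<Rightarrow> ('a \<times> 'a) set" where
  "edges P = {(v, w). v \<in> vertices P \<and> w \<in> vertices P \<and> closed_segment v w edge_of P}"

definition simple_polytope :: "'a::euclidean_space set \<Rightarrow> bool" where
  "simple_polytope P \<longleftrightarrow>
     polytope P \<and> (\<forall>v\<in>vertices P. int (card {F. F facet_of P \<and> v \<in> F}) = aff_dim P)"


section \<open>Acyclic unique sink orientations\<close>

text \<open>An orientation is given by its set \<open>A\<close> of arcs: every edge is directed in exactly one way.\<close>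

definition orientation_of :: "('a \<times> 'a) set \<Rightarrow> 'a::euclidean_space set \<Rightarrow> bool" where
  "orientation_of A P \<longleftrightarrow> A \<union> A\<inverse> = edges P \<and> A \<inter> A\<inverse> = {}"

text \<open>\<open>v\<close> is a sink of the subgraph of \<open>A\<close> induced by the vertex set \<open>V\<close>.\<close>

definition is_sink :: "'a set \<Rightarrow> ('a \<times> 'a) set \<Rightarrow> 'a \<Rightarrow> bool" where
  "is_sink V A v \<longleftrightarrow> v \<in> V \<and> (\<forall>w\<in>V. (v, w) \<notin> A)"

definition AUSO :: "('a \<times> 'a) set \<Rightarrow> 'a::euclidean_space set \<Rightarrow> bool" where
  "AUSO A P \<longleftrightarrow>
     orientation_of A P \<and> acyclic A \<and>
     (\<forall>F. F face_of P \<and> F \<noteq> {} \<longrightarrow> (\<exists>!v. is_sink (vertices F) A v))"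

definition global_sink :: "'a set \<Rightarrow> ('a \<times> 'a) set \<Rightarrow> 'a" where
  "global_sink V A = (THE v. is_sink V A v)"

definition monotone_decreasing :: "('a \<times> 'a) set \<Rightarrow> ('a \<Rightarrow> int) \<Rightarrow> bool" where
  "monotone_decreasing A l \<longleftrightarrow> (\<forall>(v, w)\<in>A. l v \<ge> l w)"

definition effectively_decreasing :: "'a set \<Rightarrow> ('a \<times> 'a) set \<Rightarrow> ('a \<Rightarrow> int) \<Rightarrow> bool" where
  "effectively_decreasing V A l \<longleftrightarrow>
     monotone_decreasing A l \<and>
     (\<forall>v\<in>V. v \<noteq> global_sink V A \<longrightarrow> (\<exists>w. (v, w) \<in> A \<and> l v > l w))"


section \<open>The random edge algorithm\<close>

text \<open>
  One step of the algorithm. Choosing an outgoing arc \<open>(v, w)\<close> uniformly is the same as choosing its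
  head \<open>w\<close> uniformly from \<open>A `` {v}\<close>. The stopped algorithm stays at the global sink, so that its
  trajectories are infinite sequences of vertices.
\<close>

definition random_edge_step :: "'a set \<Rightarrow> ('a \<times> 'a) set \<Rightarrow> 'a \<Rightarrow> 'a pmf" where
  "random_edge_step V A v =
     (if v = global_sink V A then return_pmf v else pmf_of_set (A `` {v}))"

text \<open>The law of the \<open>n\<close>-th vertex visited, given the previously visited vertices \<open>\<omega> 0, \<dots>, \<omega> (n - 1)\<close>.\<close>

definition random_edge_kernel ::
    "'a set \<Rightarrow> ('a \<times> 'a) set \<Rightarrow> 'a \<Rightarrow> nat \<Rightarrow> (nat \<Rightarrow> 'a) \<Rightarrow> 'a measure" where
  "random_edge_kernel V A v\<^sub>0 n \<omega> =
     measure_pmf (case n of 0 \<Rightarrow> return_pmf v\<^sub>0 | Suc m \<Rightarrow> random_edge_step V A (\<omega> m))"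

interpretation random_edge: Ionescu_Tulcea "random_edge_kernel V A v\<^sub>0" "\<lambda>_. count_space UNIV"
  for V :: "'a set" and A :: "('a \<times> 'a) set" and v\<^sub>0 :: 'a
proof (rule Ionescu_Tulcea.intro)
  fix i :: nat
  show "random_edge_kernel V A v\<^sub>0 i \<in> measurable (PiM {0..<i} (\<lambda>_. count_space UNIV))
          (subprob_algebra (count_space UNIV))"
  proof (cases i)
    case 0
    then show ?thesis
      by (simp add: random_edge_kernel_def[abs_def] measure_pmf_in_subprob_algebra)
  next
    case (Suc m)
    have "(\<lambda>x. measure_pmf (random_edge_step V A x))
            \<in> measurable (count_space UNIV) (subprob_algebra (count_space UNIV))"
      by (simp add: measure_pmf_in_subprob_algebra)
    moreover have "(\<lambda>\<omega>. \<omega> m) \<in> measurable (PiM {0..<i} (\<lambda>_. count_space UNIV)) (count_space UNIV)"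
      using Suc by (intro measurable_component_singleton) auto
    ultimately have "(\<lambda>\<omega>. measure_pmf (random_edge_step V A (\<omega> m)))
        \<in> measurable (PiM {0..<i} (\<lambda>_. count_space UNIV)) (subprob_algebra (count_space UNIV))"
      by (rule measurable_compose[rotated])
    then show ?thesis
      by (simp add: random_edge_kernel_def[abs_def] Suc)
  qed
next
  fix i :: nat and x :: "nat \<Rightarrow> 'a"
  show "prob_space (random_edge_kernel V A v\<^sub>0 i x)"
    by (simp add: random_edge_kernel_def measure_pmf.prob_space_axioms)
qed

text \<open>
  The law of the trajectory of the algorithm started at \<open>v\<^sub>0\<close>: the probability measure on sequences of
  vertices determined by the above kernels through the Ionescu-Tulcea theorem.
\<close>

definition random_edge_law :: "'a set \<Rightarrow> ('a \<times> 'a) set \<Rightarrow> 'a \<Rightarrow> (nat \<Rightarrow> 'a) measure" where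
  "random_edge_law V A v\<^sub>0 = random_edge.PF.lim V A v\<^sub>0"

text \<open>
  The number of pivot steps on the trajectory \<open>\<omega>\<close> until the global sink is reached, which is \<open>\<infinity>\<close>
  (the infimum of the empty set) if it is never reached.
\<close>

definition pivot_steps :: "'a set \<Rightarrow> ('a \<times> 'a) set \<Rightarrow> (nat \<Rightarrow> 'a) \<Rightarrow> ennreal" where
  "pivot_steps V A \<omega> = (INF n\<in>{n. \<omega> n = global_sink V A}. of_nat n)"

definition expected_pivot_steps :: "'a set \<Rightarrow> ('a \<times> 'a) set \<Rightarrow> 'a \<Rightarrow> ennreal" where
  "expected_pivot_steps V A v\<^sub>0 = (\<integral>\<^sup>+ \<omega>. pivot_steps V A \<omega> \<partial>random_edge_law V A v\<^sub>0)"

text \<open>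
  The law is a probability measure and the number of pivot steps is measurable, so the integral above
  is a genuine expectation.
\<close>

lemma sets_random_edge_law [measurable_cong]:
  "sets (random_edge_law V A v\<^sub>0) = sets (PiM UNIV (\<lambda>_. count_space UNIV))"
  by (simp add: random_edge_law_def)

lemma prob_space_random_edge_law: "prob_space (random_edge_law V A v\<^sub>0)"
proof (rule prob_spaceI)
  have "emeasure (random_edge.PF.lim V A v\<^sub>0)
      (random_edge.PF.emb UNIV {} (space (PiM {} (\<lambda>_. count_space UNIV)))) = 1"
  proof (subst random_edge.lim)
    interpret CI: prob_space "random_edge.CI V A v\<^sub>0 {}"
      by (rule random_edge.PF.prob_space_P) auto
    show "emeasure (random_edge.CI V A v\<^sub>0 {}) (space (PiM {} (\<lambda>_. count_space UNIV))) = 1"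
      using CI.emeasure_space_1 by (simp add: random_edge.CI_def)
  qed auto
  then show "emeasure (random_edge_law V A v\<^sub>0) (space (random_edge_law V A v\<^sub>0)) = 1"
    by (simp add: random_edge_law_def prod_emb_def space_PiM vimage_def restrict_def)
qed

lemma measurable_pivot_steps:
  "pivot_steps V A \<in> borel_measurable (random_edge_law V A v\<^sub>0)"
proof -
  have "pivot_steps V A = (\<lambda>\<omega>. INF n. if \<omega> n = global_sink V A then of_nat n else top)"
  proof
    fix \<omega>
    show "pivot_steps V A \<omega> = (INF n. if \<omega> n = global_sink V A then of_nat n else top)"
      unfolding pivot_steps_def
    proof (rule antisym)
      show "(INF n\<in>{n. \<omega> n = global_sink V A}. of_nat n)
              \<le> (INF n. if \<omega> n = global_sink V A then of_nat n else (top :: ennreal))"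
        by (rule INF_greatest) (simp add: INF_lower)
      show "(INF n. if \<omega> n = global_sink V A then of_nat n else (top :: ennreal))
              \<le> (INF n\<in>{n. \<omega> n = global_sink V A}. of_nat n)"
      proof (rule INF_greatest)
        fix n assume "n \<in> {n. \<omega> n = global_sink V A}"
        then show "(INF n. if \<omega> n = global_sink V A then of_nat n else (top :: ennreal)) \<le> of_nat n"
          by (intro INF_lower2[of n]) auto
      qed
    qed
  qed
  moreover have "(\<lambda>\<omega>. INF n. if \<omega> n = global_sink V A then of_nat n else top :: ennreal)
      \<in> borel_measurable (random_edge_law V A v\<^sub>0)"
    by measurable
  ultimately show ?thesis by simp
qed

end

theory Submission
  imports Defs
begin

text \<open>
  Every edge at a vertex \<open>v\<close> of a simple \<open>d\<close>-polytope lies in exactly \<open>d - 1\<close> of the \<open>d\<close> facets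
  at \<open>v\<close> and is determined by them, so \<open>v\<close> has at most \<open>d\<close> neighbours. Hence every step of the
  random edge algorithm decreases \<open>\<lambda>\<close> with probability at least \<open>1/d\<close>, and \<open>d\<close> times the
  number of values of \<open>\<lambda>\<close> below \<open>\<lambda>(v)\<close> decreases by at least \<open>1\<close> in expectation in every step.
\<close>

section \<open>Degrees in the graph of a simple polytope\<close>

text \<open>Otherwise \<open>F\<close> would be a proper face of \<open>G\<close> and so have
  smaller dimension, but all facets of \<open>S\<close> have dimension
  \<open>aff_dim S - 1\<close>.\<close>

lemma facet_of_unique_subset:
  assumes "convex S" "F facet_of S" "G facet_of S" "F \<subseteq> G"
  shows "F = G"
proof (rule ccontr)
  assume "F \<noteq> G"
  have G: "G face_of S" using assms(3) by (rule facet_of_imp_face_of)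
  have "F face_of G"
    using face_of_subset[OF facet_of_imp_face_of[OF assms(2)] assms(4) face_of_imp_subset[OF G]] .
  then have "aff_dim F < aff_dim G"
    using face_of_aff_dim_lt[OF face_of_imp_convex[OF G]] \<open>F \<noteq> G\<close> by blast
  then show False
    using assms by (simp add: facet_of_def)
qed

text \<open>
  A facet \<open>R\<close> of a facet \<open>F\<close> is the intersection of \<open>F\<close> with another facet, and this facet
  determines \<open>R\<close>; so passing from \<open>F\<close> to \<open>P\<close> adds at least the facet \<open>F\<close> itself.
\<close>

lemma aff_dim_diff_le_card_facets:
  fixes P :: "'a::euclidean_space set"
  assumes "polytope P" "f face_of P" "f \<noteq> {}"
  shows "aff_dim P - aff_dim f \<le> int (card {F. F facet_of P \<and> f \<subseteq> F})"
  using assms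
\<comment> \<open>Induction on the codimension of \<open>f\<close>; \<open>P\<close> varies so that
  the hypothesis applies to a facet of \<open>P\<close> containing \<open>f\<close>.\<close>
proof (induction "nat (aff_dim P - aff_dim f)" arbitrary: P rule: less_induct)
  case less
  note pP = \<open>polytope P\<close> and fP = \<open>f face_of P\<close> and ne = \<open>f \<noteq> {}\<close>
  have cP: "convex P" using pP polytope_imp_convex by blast
  have polP: "polyhedron P" using pP polytope_imp_polyhedron by blast
  show ?case
  proof (cases "f = P")
    case False
    obtain F where F: "F facet_of P" "f \<subseteq> F"
      using face_of_polyhedron_subset_facet[OF polP fP ne False] by blast
    have FP: "F face_of P" and dimF: "aff_dim F = aff_dim P - 1"
      using F by (auto simp: facet_of_def)
    have pF: "polytope F" using pP FP face_of_polytope_polytope by blast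
    have cF: "convex F" using pF polytope_imp_convex by blast
    have fF: "f face_of F"
      using face_of_subset[OF fP F(2) face_of_imp_subset[OF FP]] .
    have lt: "aff_dim f < aff_dim P" using face_of_aff_dim_lt[OF cP fP False] .
    have IH: "aff_dim F - aff_dim f \<le> int (card {R. R facet_of F \<and> f \<subseteq> R})"
      using less.hyps[OF _ pF fF ne] lt dimF by simp
    have "\<exists>G. G facet_of P \<and> f \<subseteq> G \<and> G \<noteq> F \<and> R = F \<inter> G"
      if R: "R facet_of F" "f \<subseteq> R" for R
    proof -
      have RF: "R face_of F" "R \<noteq> {}" "aff_dim R = aff_dim F - 1"
        using R by (auto simp: facet_of_def)
      have RP: "R face_of P" using RF(1) FP face_of_trans by blast
      have "R \<noteq> P" using RF(3) dimF by auto
      then have Req: "R = \<Inter>{G. G facet_of P \<and> R \<subseteq> G}"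
        using face_of_polyhedron[OF polP RP] RF(2) by blast
      have "\<exists>G. G facet_of P \<and> R \<subseteq> G \<and> G \<noteq> F"
      proof (rule ccontr)
        assume "\<not> ?thesis"
        then have "{G. G facet_of P \<and> R \<subseteq> G} \<subseteq> {F}" by auto
        then have "\<Inter>{F} \<subseteq> \<Inter>{G. G facet_of P \<and> R \<subseteq> G}" by (rule Inter_anti_mono)
        then have "F \<subseteq> R" using Req by simp
        then have "R = F" using RF(1) face_of_imp_subset by blast
        then show False using RF(3) by simp
      qed
      then obtain G where G: "G facet_of P" "R \<subseteq> G" "G \<noteq> F" by blast
      \<comment> \<open>\<open>F \<inter> G\<close> is a proper face of \<open>F\<close>, so its
        dimension is at most that of \<open>R\<close>. As \<open>R\<close> is a face of
        \<open>F \<inter> G\<close>, the two coincide.\<close>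
      have "F \<inter> G \<noteq> F"
        using facet_of_unique_subset[OF cP F(1) G(1)] G(3) by blast
      moreover have FG: "F \<inter> G face_of F"
        using face_of_subset[OF face_of_Int[OF FP facet_of_imp_face_of[OF G(1)]]]
          face_of_imp_subset[OF FP] by blast
      ultimately have "aff_dim (F \<inter> G) < aff_dim F"
        using face_of_aff_dim_lt[OF cF] by blast
      moreover have "R face_of F \<inter> G"
        using face_of_subset[OF RF(1), of "F \<inter> G"] G(2) face_of_imp_subset[OF RF(1)] by blast
      ultimately have "R = F \<inter> G"
        using face_of_aff_dim_lt[of "F \<inter> G" R] face_of_imp_convex[OF FG] RF(3) by fastforce
      then show ?thesis using G R by blast
    qed
    then obtain g where g: "\<And>R. R facet_of F \<Longrightarrow> f \<subseteq> R \<Longrightarrow>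
        g R facet_of P \<and> f \<subseteq> g R \<and> g R \<noteq> F \<and> R = F \<inter> g R"
      by metis
    have fin: "finite {G. G facet_of P \<and> f \<subseteq> G}"
      using finite_polytope_facets[OF pP] by (rule finite_subset[rotated]) auto
    have "card {R. R facet_of F \<and> f \<subseteq> R} \<le> card ({G. G facet_of P \<and> f \<subseteq> G} - {F})"
    proof (rule card_inj_on_le[where f = g])
      show "inj_on g {R. R facet_of F \<and> f \<subseteq> R}"
        using g by (metis (no_types, lifting) inj_onI mem_Collect_eq)
      show "g ` {R. R facet_of F \<and> f \<subseteq> R} \<subseteq> {G. G facet_of P \<and> f \<subseteq> G} - {F}"
        using g by blast
    qed (use fin in simp)
    moreover have "card {G. G facet_of P \<and> f \<subseteq> G} = Suc (card ({G. G facet_of P \<and> f \<subseteq> G} - {F}))"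
      using card.remove[OF fin] F by simp
    ultimately show ?thesis using IH dimF by linarith
  qed simp
qed

text \<open>With \<open>d = aff_dim P\<close>, sending a neighbour to the set of facets through the
  corresponding edge is an injection into the \<open>(d-1)\<close>-subsets of the \<open>d\<close>
  facets at \<open>v\<close>, and there are \<open>d\<close> such subsets. The bound
  \<open>d \<ge> 2\<close> makes edges proper faces, hence intersections of facets.\<close>

lemma card_neighbours_le_aff_dim:
  fixes P :: "'a::euclidean_space set"
  assumes "simple_polytope P" and d: "aff_dim P \<ge> 2" and v: "v \<in> vertices P"
  shows "finite (edges P `` {v})" "int (card (edges P `` {v})) \<le> aff_dim P"
proof -
  have pP: "polytope P" using assms by (simp add: simple_polytope_def)
  have polP: "polyhedron P" using pP polytope_imp_polyhedron by blast
  define N where "N = edges P `` {v}"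
  define E where "E w = {F. F facet_of P \<and> closed_segment v w \<subseteq> F}" for w
  define Fs where "Fs = {F. F facet_of P \<and> v \<in> F}"
  have finFs: "finite Fs"
    unfolding Fs_def using finite_polytope_facets[OF pP] by (rule finite_subset[rotated]) auto
  have cardFs: "int (card Fs) = aff_dim P"
    using assms v by (simp add: simple_polytope_def Fs_def)
  have vf: "{v} face_of P" using v by (simp add: vertices_def face_of_singleton)
  have "{v} \<noteq> P" using d by (metis aff_dim_sing not_numeral_le_zero)
  then have Fs_eq: "{v} = \<Inter>Fs"
    using face_of_polyhedron[OF polP vf] by (simp add: Fs_def)
  have edge: "closed_segment v w face_of P" "aff_dim (closed_segment v w) = 1" if "w \<in> N" for w
    using that by (auto simp: N_def edges_def edge_of_def)
  have E_eq: "closed_segment v w = \<Inter>(E w)" if "w \<in> N" for w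
    unfolding E_def
    by (rule face_of_polyhedron[OF polP edge(1)[OF that]]) (use edge(2)[OF that] d in auto)
  have E_sub: "E w \<subseteq> Fs" for w
    by (auto simp: E_def Fs_def)
  \<comment> \<open>If every facet at \<open>v\<close> contained the edge, the edge would lie in
    their intersection \<open>{v}\<close>. Conversely, its codimension \<open>d - 1\<close> forces
    at least \<open>d - 1\<close> facets.\<close>
  have E_card: "card (E w) = card Fs - 1" if "w \<in> N" for w
  proof -
    have "E w \<noteq> Fs"
      using E_eq[OF that] Fs_eq edge(2)[OF that] by (metis aff_dim_sing zero_neq_one)
    then have "card (E w) < card Fs"
      using E_sub finFs by (meson psubsetI psubset_card_mono)
    moreover have "aff_dim P - 1 \<le> int (card (E w))"
      using aff_dim_diff_le_card_facets[OF pP edge(1)[OF that]] edge(2)[OF that]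
      by (simp add: E_def)
    ultimately show ?thesis using cardFs by linarith
  qed
  have inj: "inj_on E N"
  proof (rule inj_onI)
    fix w w' assume "w \<in> N" "w' \<in> N" "E w = E w'"
    then have "closed_segment v w = closed_segment v w'" using E_eq by simp
    then show "w = w'" by (auto simp: closed_segment_eq doubleton_eq_iff)
  qed
  have img: "E ` N \<subseteq> {B. B \<subseteq> Fs \<and> card B = card Fs - 1}"
    using E_sub E_card by blast
  have fin: "finite {B. B \<subseteq> Fs \<and> card B = card Fs - 1}" using finFs by simp
  have "card N \<le> card Fs choose (card Fs - 1)"
    using card_inj_on_le[OF inj img fin] by (simp add: n_subsets[OF finFs])
  also have "\<dots> = card Fs"
    using cardFs d by (cases "card Fs") auto
  finally have "int (card N) \<le> aff_dim P" using cardFs by simp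
  moreover have "finite N" using inj_on_finite[OF inj img fin] .
  ultimately show "finite (edges P `` {v})" "int (card (edges P `` {v})) \<le> aff_dim P"
    by (simp_all add: N_def)
qed

section \<open>Marginal laws of the random edge algorithm\<close>

text \<open>The trajectory law is a projective limit whose marginal on times \<open>0\<close> to
  \<open>n\<close> is the finite-stage measure \<open>C\<close>; the integrand depends only on time
  \<open>n\<close>.\<close>

lemma nn_integral_random_edge_law_eq_C:
  "(\<integral>\<^sup>+\<omega>. h (\<omega> n) \<partial>random_edge_law V A v\<^sub>0) =
   (\<integral>\<^sup>+\<omega>. h (\<omega> n) \<partial>random_edge.C V A v\<^sub>0 0 (Suc n) (\<lambda>_. undefined))"
proof -
  let ?J = "{0..<Suc n}"
  let ?M = "PiM ?J (\<lambda>_. count_space UNIV :: 'a measure)"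
  have [measurable]: "(\<lambda>\<omega>. h (\<omega> n)) \<in> borel_measurable ?M"
    by (rule measurable_compose[OF measurable_component_singleton]) auto
  have up: "random_edge.up_to ?J = Suc n"
    by (intro antisym) (auto simp: random_edge.up_to_iff intro!: random_edge.up_to_less Suc_leI)
  have r: "(\<lambda>x. restrict x ?J) \<in> measurable (PiM UNIV (\<lambda>_. count_space UNIV)) ?M"
    by (rule measurable_restrict_subset) simp
  have "(\<integral>\<^sup>+\<omega>. h (\<omega> n) \<partial>random_edge_law V A v\<^sub>0) =
        (\<integral>\<^sup>+\<omega>. h (\<omega> n) \<partial>distr (random_edge_law V A v\<^sub>0) ?M (\<lambda>x. restrict x ?J))"
    by (subst nn_integral_distr)
      (use r in \<open>simp_all add: measurable_cong_sets[OF sets_random_edge_law refl]\<close>)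
  also have "\<dots> = (\<integral>\<^sup>+\<omega>. h (\<omega> n) \<partial>random_edge.CI V A v\<^sub>0 ?J)"
    unfolding random_edge_law_def by (subst random_edge.distr_lim) auto
  also have "\<dots> = (\<integral>\<^sup>+\<omega>. h (\<omega> n) \<partial>random_edge.C V A v\<^sub>0 0 (Suc n) (\<lambda>_. undefined))"
    unfolding random_edge.CI_def up
    by (subst nn_integral_distr)
      (auto simp: measurable_cong_sets[OF random_edge.sets_C refl] simp del: random_edge.C.simps
        intro!: measurable_restrict)
  finally show ?thesis .
qed

lemma nn_integral_random_edge_C_Suc:
  "(\<integral>\<^sup>+\<omega>. h (\<omega> n) \<partial>random_edge.C V A v\<^sub>0 0 (Suc n) (\<lambda>_. undefined)) =
   (\<integral>\<^sup>+\<omega>. (\<integral>\<^sup>+x. h x \<partial>random_edge_kernel V A v\<^sub>0 n \<omega>) \<partial>random_edge.C V A v\<^sub>0 0 n (\<lambda>_. undefined))"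
proof -
  let ?M = "\<lambda>n::nat. PiM {0..<n} (\<lambda>_. count_space UNIV :: 'a measure)"
  have m: "(\<lambda>\<omega>. h (\<omega> n)) \<in> borel_measurable (?M (Suc n))"
    by (rule measurable_compose[OF measurable_component_singleton]) auto
  \<comment> \<open>The constant \<open>undefined\<close> is the empty trajectory, the only point of
    the product over no indices.\<close>
  have u: "(\<lambda>_. undefined) \<in> space (?M 0)" by simp
  have sC: "sets (random_edge.C V A v\<^sub>0 0 n (\<lambda>_. undefined)) = sets (?M n)"
    using random_edge.sets_C[OF u] by simp
  have eP: "random_edge.eP V A v\<^sub>0 n \<in> measurable (random_edge.C V A v\<^sub>0 0 n (\<lambda>_. undefined))
      (subprob_algebra (?M (Suc n)))"
    unfolding measurable_cong_sets[OF sC refl] by (rule random_edge.measurable_eP)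
  show ?thesis
    unfolding random_edge.C.simps
    using nn_integral_bind[OF m, of "random_edge.eP V A v\<^sub>0 n" "random_edge.C V A v\<^sub>0 0 n (\<lambda>_. undefined)"] eP
    by (auto simp: random_edge.nn_integral_eP random_edge.space_C[OF u] m intro!: nn_integral_cong)
qed

lemma nn_integral_random_edge_law_0:
  "(\<integral>\<^sup>+\<omega>. h (\<omega> 0) \<partial>random_edge_law V A v\<^sub>0) = h v\<^sub>0"
  unfolding nn_integral_random_edge_law_eq_C nn_integral_random_edge_C_Suc
  by (simp add: random_edge_kernel_def nn_integral_return)

text \<open>The one-step Markov property: the kernel at time \<open>Suc n\<close> looks only at the
  vertex visited at time \<open>n\<close>.\<close>

lemma nn_integral_random_edge_law_Suc:
  "(\<integral>\<^sup>+\<omega>. h (\<omega> (Suc n)) \<partial>random_edge_law V A v\<^sub>0) =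
   (\<integral>\<^sup>+\<omega>. (\<integral>\<^sup>+x. h x \<partial>random_edge_step V A (\<omega> n)) \<partial>random_edge_law V A v\<^sub>0)"
  unfolding nn_integral_random_edge_law_eq_C[where h = h]
    nn_integral_random_edge_law_eq_C[where h = "\<lambda>v. \<integral>\<^sup>+x. h x \<partial>random_edge_step V A v"]
    nn_integral_random_edge_C_Suc[where h = h]
  by (simp add: random_edge_kernel_def del: random_edge.C.simps)

section \<open>Drift bound for the expected number of pivot steps\<close>

text \<open>Each time before the first visit to the sink contributes \<open>1\<close>, and without
  such a visit the sum is infinite. A sum over times can be integrated term by term.\<close>

lemma pivot_steps_le_suminf:
  "pivot_steps V A \<omega> \<le> (\<Sum>n. indicator (- {global_sink V A}) (\<omega> n))"
proof (cases "\<exists>n. \<omega> n = global_sink V A")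
  case True
  define N where "N = (LEAST n. \<omega> n = global_sink V A)"
  have N: "\<omega> N = global_sink V A" unfolding N_def using True by (rule LeastI_ex)
  have less: "\<omega> n \<noteq> global_sink V A" if "n < N" for n
    using not_less_Least[of n] that unfolding N_def by blast
  have "pivot_steps V A \<omega> \<le> of_nat N"
    unfolding pivot_steps_def using N by (intro INF_lower) auto
  also have "of_nat N = (\<Sum>n<N. indicator (- {global_sink V A}) (\<omega> n) :: ennreal)"
    using less by (simp add: indicator_def)
  also have "\<dots> \<le> (\<Sum>n. indicator (- {global_sink V A}) (\<omega> n))"
    by (rule sum_le_suminf) auto
  finally show ?thesis .
next
  case False
  then have "(\<Sum>n. indicator (- {global_sink V A}) (\<omega> n) :: ennreal) = (\<Sum>n. 1)"
    by (simp add: indicator_def)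
  also have "\<dots> = top"
    by (simp add: suminf_eq_SUP ennreal_SUP_of_nat_eq_top)
  finally show ?thesis by simp
qed

text \<open>Foster-Lyapunov argument: each step off the sink costs \<open>1\<close> and is paid for
  by an expected drop of the potential \<open>f\<close>, whose initial value is the whole
  budget.\<close>

lemma expected_pivot_steps_le_potential:
  fixes f :: "'a \<Rightarrow> ennreal"
  assumes v\<^sub>0: "v\<^sub>0 \<in> V" and A: "\<And>v. v \<in> V \<Longrightarrow> v \<noteq> global_sink V A \<Longrightarrow>
    A `` {v} \<noteq> {} \<and> finite (A `` {v}) \<and> A `` {v} \<subseteq> V"
    and drift: "\<And>v. v \<in> V \<Longrightarrow> v \<noteq> global_sink V A \<Longrightarrow>
    1 + (\<integral>\<^sup>+w. f w \<partial>pmf_of_set (A `` {v})) \<le> f v"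
  shows "expected_pivot_steps V A v\<^sub>0 \<le> f v\<^sub>0"
proof -
  let ?L = "random_edge_law V A v\<^sub>0"
  let ?i = "indicator (- {global_sink V A}) :: 'a \<Rightarrow> ennreal"
  \<comment> \<open>The infinite value off \<open>V\<close> makes the drift inequality hold everywhere.\<close>
  define g where "g v = (if v \<in> V then f v else top)" for v
  have g: "?i v + (\<integral>\<^sup>+w. g w \<partial>random_edge_step V A v) \<le> g v" for v
  proof (cases "v \<in> V \<and> v \<noteq> global_sink V A")
    case True
    then have N: "A `` {v} \<noteq> {}" "finite (A `` {v})" "A `` {v} \<subseteq> V" using A by auto
    have "(\<integral>\<^sup>+w. g w \<partial>pmf_of_set (A `` {v})) = (\<integral>\<^sup>+w. f w \<partial>pmf_of_set (A `` {v}))"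
      using N by (intro nn_integral_cong_AE) (auto simp: AE_measure_pmf_iff g_def)
    then show ?thesis using True drift[of v] by (simp add: random_edge_step_def g_def)
  next
    case False
    \<comment> \<open>Off \<open>V\<close> the right side is infinite; at the sink the indicator
      vanishes and the step stays put, which gives equality.\<close>
    then show ?thesis by (auto simp: random_edge_step_def g_def)
  qed
  have [measurable]: "(\<lambda>\<omega>. h (\<omega> n)) \<in> borel_measurable ?L" for h :: "'a \<Rightarrow> ennreal" and n
    by (subst measurable_cong_sets[OF sets_random_edge_law refl],
        rule measurable_compose[OF measurable_component_singleton]) auto
  \<comment> \<open>Expected cost so far plus expected remaining potential never exceeds the initial
    potential. Dropping the latter leaves a bound uniform in \<open>N\<close>.\<close>
  have "(\<Sum>n<N. \<integral>\<^sup>+\<omega>. ?i (\<omega> n) \<partial>?L) + (\<integral>\<^sup>+\<omega>. g (\<omega> N) \<partial>?L) \<le> g v\<^sub>0" for N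
  proof (induction N)
    case 0
    then show ?case by (simp add: nn_integral_random_edge_law_0)
  next
    case (Suc N)
    have "(\<integral>\<^sup>+\<omega>. ?i (\<omega> N) \<partial>?L) + (\<integral>\<^sup>+\<omega>. g (\<omega> (Suc N)) \<partial>?L) =
        (\<integral>\<^sup>+\<omega>. (?i (\<omega> N) + (\<integral>\<^sup>+w. g w \<partial>random_edge_step V A (\<omega> N))) \<partial>?L)"
      unfolding nn_integral_random_edge_law_Suc
      by (subst nn_integral_add[symmetric]) auto
    also have "\<dots> \<le> (\<integral>\<^sup>+\<omega>. g (\<omega> N) \<partial>?L)"
      by (intro nn_integral_mono g)
    finally show ?case
      using Suc.IH by (simp add: add.assoc) (meson add_left_mono order_trans)
  qed
  then have bound: "(\<Sum>n<N. \<integral>\<^sup>+\<omega>. ?i (\<omega> n) \<partial>?L) \<le> g v\<^sub>0" for N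
    by (meson le_iff_add order_trans)
  have "expected_pivot_steps V A v\<^sub>0 \<le> (\<integral>\<^sup>+\<omega>. (\<Sum>n. ?i (\<omega> n)) \<partial>?L)"
    unfolding expected_pivot_steps_def by (intro nn_integral_mono pivot_steps_le_suminf)
  also have "\<dots> = (\<Sum>n. \<integral>\<^sup>+\<omega>. ?i (\<omega> n) \<partial>?L)"
    by (rule nn_integral_suminf) auto
  also have "\<dots> \<le> g v\<^sub>0"
    by (rule suminf_le_const) (use bound in auto)
  finally show ?thesis using v\<^sub>0 by (simp add: g_def)
qed

text \<open>The potential is \<open>d * c v\<close>, where the rank \<open>c v\<close> counts the
  values of \<open>l\<close> below \<open>l v\<close>. The factor \<open>d\<close> turns an average
  loss of rank of at least \<open>1/d\<close> into a loss of at least \<open>1\<close>.\<close>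

lemma expected_pivot_steps_le_max_outdegree:
  fixes A :: "('a \<times> 'a) set"
  assumes "finite V" "A \<subseteq> V \<times> V" "v\<^sub>0 \<in> V" "effectively_decreasing V A l"
    and deg: "\<And>v. v \<in> V \<Longrightarrow> card (A `` {v}) \<le> d"
  shows "expected_pivot_steps V A v\<^sub>0 \<le> of_nat d * of_nat (card (l ` V))"
proof -
  define c where "c v = card (l ` V \<inter> {..<l v})" for v
  have mono: "c w \<le> c v" if "(v, w) \<in> A" for v w
    unfolding c_def using that assms
    by (intro card_mono)
      (auto simp: effectively_decreasing_def monotone_decreasing_def dest!: bspec)
  have strict: "c w < c v" if "(v, w) \<in> A" "l w < l v" for v w
    unfolding c_def using that assms by (intro psubset_card_mono) auto
  have "expected_pivot_steps V A v\<^sub>0 \<le> of_nat (d * c v\<^sub>0)"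
  proof (rule expected_pivot_steps_le_potential)
    fix v assume v: "v \<in> V" "v \<noteq> global_sink V A"
    let ?N = "A `` {v}"
    obtain w where w: "(v, w) \<in> A" "l w < l v"
      using assms(4) v by (auto simp: effectively_decreasing_def)
    have sub: "?N \<subseteq> V" using assms(2) by auto
    have fin: "finite ?N" using sub assms(1) finite_subset by blast
    show "?N \<noteq> {} \<and> finite ?N \<and> ?N \<subseteq> V" using w sub fin by auto
    have card: "card ?N > 0" using w fin by (auto simp: card_gt_0_iff)
    \<comment> \<open>No outgoing arc raises the rank and the arc to \<open>w\<close> lowers it; by
      integrality the total loss is at least \<open>1\<close>.\<close>
    have "(\<Sum>u\<in>?N. c u) < (\<Sum>u\<in>?N. c v)"
      using w fin mono strict by (intro sum_strict_mono_ex1) (auto intro!: bexI[of _ w])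
    then have "(\<Sum>u\<in>?N. c u) + 1 \<le> card ?N * c v" by simp
    then have "d * ((\<Sum>u\<in>?N. c u) + 1) \<le> d * (card ?N * c v)" by (rule mult_le_mono2)
    \<comment> \<open>The summand \<open>d\<close> is weakened to \<open>card ?N\<close>, so that
      averaging over \<open>?N\<close> leaves a loss of exactly \<open>1\<close>.\<close>
    then have "(\<Sum>u\<in>?N. d * c u) + card ?N \<le> card ?N * (d * c v)"
      using deg[OF v(1)] by (simp add: sum_distrib_left algebra_simps)
    then have real: "(\<Sum>u\<in>?N. real (d * c u)) / card ?N + 1 \<le> real (d * c v)"
      using card
      by (simp add: field_simps del: of_nat_mult flip: of_nat_mult of_nat_add of_nat_sum)
    have "(\<integral>\<^sup>+u. of_nat (d * c u) \<partial>pmf_of_set ?N) = (\<Sum>u\<in>?N. of_nat (d * c u)) / (of_nat (card ?N) :: ennreal)"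
      using w fin by (subst nn_integral_pmf_of_set) auto
    also have "\<dots> = ennreal ((\<Sum>u\<in>?N. real (d * c u)) / card ?N)"
      using card by (simp only: flip: of_nat_sum) (simp add: ennreal_of_nat_eq_real_of_nat divide_ennreal sum_nonneg)
    finally have "1 + (\<integral>\<^sup>+u. of_nat (d * c u) \<partial>pmf_of_set ?N) =
        ennreal ((\<Sum>u\<in>?N. real (d * c u)) / card ?N + 1)"
      by (subst ennreal_plus) (simp_all add: sum_nonneg add.commute)
    also have "\<dots> \<le> of_nat (d * c v)"
      using real by (simp only: ennreal_of_nat_eq_real_of_nat ennreal_leI)
    finally show "1 + (\<integral>\<^sup>+u. of_nat (d * c u) \<partial>pmf_of_set ?N) \<le> (of_nat (d * c v) :: ennreal)" .
  qed fact
  also have "d * c v\<^sub>0 \<le> d * card (l ` V)"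
    unfolding c_def using assms(1) by (intro mult_le_mono2 card_mono) auto
  then have "of_nat (d * c v\<^sub>0) \<le> (of_nat (d * card (l ` V)) :: ennreal)"
    by (rule of_nat_mono)
  finally show ?thesis by simp
qed

theorem theorem2p2:
  fixes P :: "'a::euclidean_space set"
    and A :: "('a \<times> 'a) set"
    and v\<^sub>s\<^sub>t :: 'a
    and l :: "'a \<Rightarrow> int"
  assumes "simple_polytope P" and "aff_dim P = 4"
    and "AUSO A P"
    and "v\<^sub>s\<^sub>t \<in> vertices P"
    and "effectively_decreasing (vertices P) A l"
  shows "expected_pivot_steps (vertices P) A v\<^sub>s\<^sub>t \<le> 4 * of_nat (card (l ` vertices P))"
proof -
  have sub: "A \<subseteq> edges P"
    using assms(3) by (auto simp: AUSO_def orientation_of_def)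
  have fin: "finite (vertices P)"
    using assms(1) unfolding vertices_def simple_polytope_def
    by (simp add: finite_polyhedron_extreme_points polytope_imp_polyhedron)
  \<comment> \<open>Out-neighbours are neighbours in the graph, so the degree bound in dimension
    \<open>4\<close> supplies the outdegree bound \<open>d = 4\<close>.\<close>
  have "card (A `` {v}) \<le> 4" if "v \<in> vertices P" for v
  proof -
    have "finite (edges P `` {v})" "card (edges P `` {v}) \<le> 4"
      using card_neighbours_le_aff_dim[OF assms(1) _ that] assms(2) by simp_all
    moreover have "A `` {v} \<subseteq> edges P `` {v}"
      using sub by auto
    ultimately show ?thesis
      by (meson card_mono order_trans)
  qed
  moreover have "A \<subseteq> vertices P \<times> vertices P"
    using sub by (auto simp: edges_def)
  ultimately show ?thesis
    using expected_pivot_steps_le_max_outdegree[OF fin _ assms(4,5), of 4] by simp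
qed

end
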